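(* Let $A$ be a $d\times d$ Hermitian (deterministic) matrix and let $B$ be a $d\times d$ Hermitian random matrix. Then for every increasing, convex function $f:\mathbb{R}_+\to\mathbb{R}_+$, $$\mathrm{Tr}\Big[f\Big(\mathbb{E}[(e^A-e^B)^2]\Big)\Big]\le\frac12\mathrm{Tr}\Big[f\big(\mathbb{E}[(A-B)e^{2B}(A-B)]\big)\Big]+\frac12\mathrm{Tr}\Big[f\big(e^A\,\mathbb{E}[(A-B)^2]\,e^A\big)\Big].$$ In particular, this holds for $f:t\mapsto t^p$ when $p\ge1$.
   Context: Expectations of random matrices are entrywise and assumed to exist. For a Hermitian matrix $M=\sum_{i=1}^d\lambda_iv_iv_i^*$ (spectral decomposition) and a real function $f$ defined on the spectrum of $M$, $f(M)=\sum_{i=1}^df(\lambda_i)v_iv_i^*$. *)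

theory Defs
  imports "HOL-Probability.Probability"
begin

text \<open>A \<open>d \<times> d\<close> complex matrix is an element of \<^typ>\<open>complex^'n^'n\<close> with \<open>d = CARD('n)\<close>.  On this
  type \<open>*\<close> and powers act entrywise, so matrix products are written with \<open>**\<close> throughout.\<close>

definition hermitian :: "complex^'n^'n \<Rightarrow> bool" where
  "hermitian M \<longleftrightarrow> (\<forall>i j. M $ i $ j = cnj (M $ j $ i))"

definition rank_one :: "complex^'n \<Rightarrow> complex^'n^'n" where
  "rank_one v = (\<chi> r s. v $ r * cnj (v $ s))"

text \<open>Orthonormality refers to the complex inner product; the library's \<open>\<bullet>\<close> on \<^typ>\<open>complex^'n\<close> is
  only its real part.\<close>

definition orthonormal :: "('n::finite \<Rightarrow> complex^'n) \<Rightarrow> bool" where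
  "orthonormal v \<longleftrightarrow>
     (\<forall>i j. (\<Sum>k\<in>UNIV. v i $ k * cnj (v j $ k)) = (if i = j then 1 else 0))"

definition spectral_decomposition ::
    "complex^'n^'n \<Rightarrow> ('n::finite \<Rightarrow> real) \<Rightarrow> ('n \<Rightarrow> complex^'n) \<Rightarrow> bool" where
  "spectral_decomposition M lam v \<longleftrightarrow>
     orthonormal v \<and> M = (\<Sum>i\<in>UNIV. lam i *\<^sub>R rank_one (v i))"

text \<open>The matrix \<open>f(M)\<close> for Hermitian \<open>M\<close>.  A spectral decomposition exists, and all of them yield
  the same \<open>f(M)\<close>, so the description is unique.  Only the values of \<open>f\<close> on the spectrum of \<open>M\<close>
  matter.  For non-Hermitian \<open>M\<close> the value is unspecified.\<close>

definition matrix_fun :: "(real \<Rightarrow> real) \<Rightarrow> complex^'n^'n \<Rightarrow> complex^'n^'n" where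
  "matrix_fun f M = (THE N. \<exists>lam v. spectral_decomposition M lam v \<and>
     N = (\<Sum>i\<in>UNIV. f (lam i) *\<^sub>R rank_one (v i)))"

abbreviation matrix_exp :: "complex^'n^'n \<Rightarrow> complex^'n^'n" where
  "matrix_exp \<equiv> matrix_fun exp"

definition mat_integrable :: "'w measure \<Rightarrow> ('w \<Rightarrow> complex^'n^'n) \<Rightarrow> bool" where
  "mat_integrable P X \<longleftrightarrow> (\<forall>i j. integrable P (\<lambda>\<omega>. X \<omega> $ i $ j))"

definition mat_expectation :: "'w measure \<Rightarrow> ('w \<Rightarrow> complex^'n^'n) \<Rightarrow> complex^'n^'n" where
  "mat_expectation P X = (\<chi> i j. integral\<^sup>L P (\<lambda>\<omega>. X \<omega> $ i $ j))"

text \<open>The trace of \<open>f(M)\<close> is real for Hermitian \<open>M\<close>; \<^const>\<open>Re\<close> only changes its type.\<close>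

definition trace_fun :: "(real \<Rightarrow> real) \<Rightarrow> complex^'n^'n \<Rightarrow> real" where
  "trace_fun f M = Re (trace (matrix_fun f M))"

end

theory Submission
  imports Defs
begin

text \<open>Put \<open>\<phi>(u) = tanh (u/2) / (u/2)\<close>, so that
  \<open>e\<^sup>a - e\<^sup>b = \<phi>(a - b) \<sqdot> (e\<^sup>a + e\<^sup>b)/2 \<sqdot> (a - b)\<close>.  With \<open>D = A - B\<close>, in eigenbases of \<open>A\<close> (eigenvalues
  \<open>a\<^sub>j\<close>) and \<open>B\<close> (eigenvalues \<open>b\<^sub>k\<close>) the matrix of \<open>e\<^sup>A - e\<^sup>B\<close> is therefore the matrix of
  \<open>(e\<^sup>B D + D e\<^sup>A)/2\<close> multiplied entrywise by \<open>\<phi>(a\<^sub>j - b\<^sub>k)\<close>.  The kernel \<open>\<phi>(x - y)\<close> is positive semidefinite,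
  being an integral of kernels \<open>sech\<^sup>2\<close>, which reduce to \<open>1/(p + q)\<^sup>2\<close>.  Since \<open>\<phi>(0) = 1\<close>, a Schur
  complement shows that \<open>\<phi>(a\<^sub>j - a\<^sub>l) - \<phi>(a\<^sub>j - b) \<phi>(a\<^sub>l - b)\<close> is positive semidefinite for every \<open>b\<close>; this
  removes the random eigenvalues and gives, pointwise and hence in expectation,
  \<open>(e\<^sup>A - e\<^sup>B)\<^sup>2 \<le> \<Phi>(D e\<^sup>2\<^sup>B D)/2 + \<Phi>(e\<^sup>A D\<^sup>2 e\<^sup>A)/2\<close>, where the deterministic map \<open>\<Phi>\<close> multiplies entrywise
  by \<open>\<phi>(a\<^sub>j - a\<^sub>l)\<close> in the eigenbasis of \<open>A\<close>.  As \<open>\<Phi>\<close> is positive, unital and trace preserving, Jensen's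
  inequality in the eigenbasis of the left-hand side concludes.\<close>

subsection \<open>The kernel of the hyperbolic tangent\<close>

text \<open>This is \<phi> of the overview, extended continuously to 0. The value 1 there is the
  diagonal of the kernel: it normalises the Schur complement and makes \<Phi> unital and trace
  preserving.\<close>

definition tanhc :: "real \<Rightarrow> real" where "tanhc u = (if u = 0 then 1 else tanh (u / 2) / (u / 2))"

lemma cauchy_square_kernel_nonneg:
  fixes p c :: "'i::finite \<Rightarrow> real"
  assumes p: "\<And>i. p i > 0"
  shows "0 \<le> (\<Sum>i\<in>UNIV. \<Sum>j\<in>UNIV. c i * c j / (p i + p j)\<^sup>2)"
proof -
  txt \<open>The Laplace transform gives \<open>1 / k\<^sup>2 = \<integral> t exp (- k t) dt\<close> over \<open>{0..}\<close>; below, \<open>F t\<close> is the form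
    with this integral truncated at \<open>t\<close>.\<close>
  define F where "F t = (\<Sum>i\<in>UNIV. \<Sum>j\<in>UNIV. c i * c j *
     (1 / (p i + p j)\<^sup>2 - (t / (p i + p j) + 1 / (p i + p j)\<^sup>2) * exp (- ((p i + p j) * t))))" for t
  have pp: "p i + p j > 0" for i j using p by (simp add: add_pos_pos)
  \<comment> \<open>Differentiating recovers the integrand. Its exponentials factor over
    \<open>i\<close> and \<open>j\<close>, so the double sum collapses to a square.\<close>
  have D: "(F has_real_derivative t * (\<Sum>i\<in>UNIV. c i * exp (- (p i * t)))\<^sup>2) (at t)" for t
  proof -
    have "(F has_real_derivative (\<Sum>i\<in>UNIV. \<Sum>j\<in>UNIV. c i * c j * (t * exp (- ((p i + p j) * t))))) (at t)"
      unfolding F_def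
    proof (intro DERIV_sum DERIV_cmult)
      fix i j
      define k where "k = p i + p j"
      have "k \<noteq> 0" using pp[of i j] by (simp add: k_def)
      then show "((\<lambda>t. 1 / (p i + p j)\<^sup>2 - (t / (p i + p j) + 1 / (p i + p j)\<^sup>2) * exp (- ((p i + p j) * t)))
         has_real_derivative t * exp (- ((p i + p j) * t))) (at t)"
        unfolding k_def[symmetric] by (auto intro!: derivative_eq_intros simp: field_simps power2_eq_square)
    qed
    also have "(\<Sum>i\<in>UNIV. \<Sum>j\<in>UNIV. c i * c j * (t * exp (- ((p i + p j) * t)))) =
        t * (\<Sum>i\<in>UNIV. c i * exp (- (p i * t)))\<^sup>2"
      unfolding power2_eq_square sum_product unfolding sum_distrib_left
      by (intro sum.cong refl) (simp add: algebra_simps exp_add[symmetric] mult_exp_exp)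
    finally show ?thesis .
  qed
  have nn: "0 \<le> F t" if "t \<ge> 0" for t
  proof -
    have "F 0 \<le> F t"
      by (rule DERIV_nonneg_imp_nondecreasing[OF that])
         (use D in \<open>meson mult_nonneg_nonneg zero_le_power2\<close>)
    then show ?thesis by (simp add: F_def)
  qed
  have "(F \<longlongrightarrow> (\<Sum>i\<in>UNIV. \<Sum>j\<in>UNIV. c i * c j * (1 / (p i + p j)\<^sup>2 - 0))) at_top"
    unfolding F_def
  proof (intro tendsto_sum tendsto_mult tendsto_diff tendsto_const)
    fix i j
    define k where "k = p i + p j"
    have "k > 0" using pp k_def by simp
    then show "((\<lambda>t. (t / (p i + p j) + 1 / (p i + p j)\<^sup>2) * exp (- ((p i + p j) * t))) \<longlongrightarrow> 0) at_top"
      unfolding k_def[symmetric] by real_asymp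
  qed
  then have "0 \<le> (\<Sum>i\<in>UNIV. \<Sum>j\<in>UNIV. c i * c j * (1 / (p i + p j)\<^sup>2 - 0))"
    by (rule tendsto_lowerbound) (auto intro!: eventually_at_top_linorderI[of 0] nn)
  then show ?thesis by simp
qed

text \<open>Since \<open>2 * cosh (x - y)\<close> is
  \<open>(exp (2 * x) + exp (2 * y)) / (exp x * exp y)\<close>, this is the preceding kernel at the
  points \<open>exp (2 * x i)\<close>, with the remaining exponentials absorbed into the
  coefficients.\<close>

lemma sech_square_kernel_nonneg:
  fixes x c :: "'i::finite \<Rightarrow> real"
  shows "0 \<le> (\<Sum>i\<in>UNIV. \<Sum>j\<in>UNIV. c i * c j / (cosh (x i - x j))\<^sup>2)"
proof -
  have "c i * c j / (cosh (x i - x j))\<^sup>2 =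
     4 * ((c i * exp (2 * x i)) * (c j * exp (2 * x j)) / (exp (2 * x i) + exp (2 * x j))\<^sup>2)" for i j
  proof -
    have "exp (x i) * exp (x j) * (2 * cosh (x i - x j)) = exp (2 * x i) + exp (2 * x j)"
      by (simp add: cosh_field_def exp_diff exp_minus field_simps power2_eq_square mult_exp_exp)
    then have "(exp (2 * x i) + exp (2 * x j))\<^sup>2 = (exp (x i) * exp (x j) * (2 * cosh (x i - x j)))\<^sup>2"
      by simp
    also have "\<dots> = 4 * exp (2 * x i) * exp (2 * x j) * (cosh (x i - x j))\<^sup>2"
      by (simp add: power_mult_distrib flip: exp_double)
    finally show ?thesis by (simp add: field_simps)
  qed
  then have "(\<Sum>i\<in>UNIV. \<Sum>j\<in>UNIV. c i * c j / (cosh (x i - x j))\<^sup>2) =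
     4 * (\<Sum>i\<in>UNIV. \<Sum>j\<in>UNIV. (c i * exp (2 * x i)) * (c j * exp (2 * x j)) / (exp (2 * x i) + exp (2 * x j))\<^sup>2)"
    by (simp add: sum_distrib_left)
  then show ?thesis
    using cauchy_square_kernel_nonneg[of "\<lambda>i. exp (2 * x i)" "\<lambda>i. c i * exp (2 * x i)"] by simp
qed

lemma tanhc_kernel_nonneg:
  fixes x c :: "'i::finite \<Rightarrow> real"
  shows "0 \<le> (\<Sum>i\<in>UNIV. \<Sum>j\<in>UNIV. tanhc (x i - x j) * c i * c j)"
proof -
  txt \<open>\<open>h u s\<close> is the integral of \<open>sech\<^sup>2 (r u / 2)\<close> over \<open>r \<in> {0..s}\<close>.\<close>
  define h where "h u s = (if u = 0 then s else tanh (s * u / 2) / (u / 2))" for u s :: real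
  have h1: "h u 1 = tanhc u" for u by (simp add: h_def tanhc_def)
  have h0: "h u 0 = 0" for u by (simp add: h_def)
  have Dh: "(h u has_real_derivative 1 / (cosh (s * u / 2))\<^sup>2) (at s)" for u s
  proof (cases "u = 0")
    case False
    have "cosh (s * u / 2) \<noteq> 0" using cosh_real_pos[of "s * u / 2"] by linarith
    then have "1 - (tanh (s * u / 2))\<^sup>2 = 1 / (cosh (s * u / 2))\<^sup>2"
      using hyperbolic_pythagoras[of "s * u / 2"]
      by (simp add: tanh_def power_divide diff_divide_eq_iff)
    then show ?thesis using False \<open>cosh (s * u / 2) \<noteq> 0\<close> unfolding h_def
      by (auto intro!: derivative_eq_intros)
  qed (simp add: h_def[abs_def])
  define G where "G s = (\<Sum>i\<in>UNIV. \<Sum>j\<in>UNIV. c i * c j * h (x i - x j) s)" for s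
  have D: "(G has_real_derivative (\<Sum>i\<in>UNIV. \<Sum>j\<in>UNIV. c i * c j * (1 / (cosh (s * (x i - x j) / 2))\<^sup>2))) (at s)" for s
    unfolding G_def by (intro DERIV_sum DERIV_cmult Dh)
  \<comment> \<open>For fixed \<open>s\<close> this is the squared sech form at the points
    \<open>s * x i / 2\<close>. Hence \<open>G\<close> increases from \<open>G 0 = 0\<close> to
    \<open>G 1\<close>, the form in question.\<close>
  have nn: "0 \<le> (\<Sum>i\<in>UNIV. \<Sum>j\<in>UNIV. c i * c j * (1 / (cosh (s * (x i - x j) / 2))\<^sup>2))" for s
    using sech_square_kernel_nonneg[of c "\<lambda>i. s * x i / 2"] by (simp add: algebra_simps diff_divide_distrib)
  have "G 0 \<le> G 1"
    by (rule DERIV_nonneg_imp_nondecreasing) (use D nn in auto)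
  then show ?thesis by (simp add: G_def h1 h0 algebra_simps)
qed

lemma tanhc_minus [simp]: "tanhc (- u) = tanhc u" by (simp add: tanhc_def)
lemma tanhc_0 [simp]: "tanhc 0 = 1" by (simp add: tanhc_def)
lemma tanhc_commute: "tanhc (x - y) = tanhc (y - x)" using tanhc_minus[of "x - y"] by simp

lemma tanhc_schur_complement:
  fixes x c :: "'i::finite \<Rightarrow> real"
  shows "(\<Sum>i\<in>UNIV. tanhc (x i - b) * c i)\<^sup>2 \<le> (\<Sum>i\<in>UNIV. \<Sum>j\<in>UNIV. tanhc (x i - x j) * c i * c j)"
proof -
  txt \<open>Adjoin \<open>b\<close> to the points, with the coefficient that minimises the extended quadratic form.\<close>
  define S where "S = (\<Sum>i\<in>UNIV. tanhc (x i - b) * c i)"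
  define y where "y = case_option b x"
  define d where "d = case_option (- S) c"
  have o: "(\<Sum>i\<in>UNIV. g i) = g None + (\<Sum>i\<in>UNIV. g (Some i))" for g :: "'i option \<Rightarrow> real"
    by (simp add: UNIV_option_conv sum.reindex)
  have "0 \<le> (\<Sum>i\<in>UNIV. \<Sum>j\<in>UNIV. tanhc (y i - y j) * d i * d j)"
    by (rule tanhc_kernel_nonneg)
  also have "\<dots> = S * S - S * (\<Sum>j\<in>UNIV. tanhc (b - x j) * c j) - S * (\<Sum>i\<in>UNIV. tanhc (x i - b) * c i)
       + (\<Sum>i\<in>UNIV. \<Sum>j\<in>UNIV. tanhc (x i - x j) * c i * c j)"
    unfolding o by (simp add: y_def d_def sum.distrib sum_distrib_left sum_negf sum_subtractf algebra_simps)
  also have "(\<Sum>j\<in>UNIV. tanhc (b - x j) * c j) = S" unfolding S_def by (simp add: tanhc_commute[of b])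
  finally show ?thesis unfolding S_def[symmetric] by (simp add: power2_eq_square)
qed

section \<open>Hermitian forms of the kernel with complex coefficients\<close>

definition tanhc_form :: "('i::finite \<Rightarrow> real) \<Rightarrow> ('i \<Rightarrow> complex) \<Rightarrow> real" where
  "tanhc_form x c = Re (\<Sum>i\<in>UNIV. \<Sum>j\<in>UNIV. complex_of_real (tanhc (x i - x j)) * c i * cnj (c j))"

text \<open>The kernel is real and symmetric, so the mixed terms contribute only to the imaginary
  part, where they cancel. The splitting transfers the real inequalities to complex
  coefficients.\<close>

lemma tanhc_form_eq: "tanhc_form x c = (\<Sum>i\<in>UNIV. \<Sum>j\<in>UNIV. tanhc (x i - x j) * Re (c i) * Re (c j)) +
    (\<Sum>i\<in>UNIV. \<Sum>j\<in>UNIV. tanhc (x i - x j) * Im (c i) * Im (c j))"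
  unfolding tanhc_form_def by (simp add: sum.distrib algebra_simps)

lemma tanhc_form_nonneg: "0 \<le> tanhc_form x c"
  unfolding tanhc_form_eq by (intro add_nonneg_nonneg tanhc_kernel_nonneg)

text \<open>The real inequality is added up over real and imaginary parts. The point
  \<open>b\<close>, later an eigenvalue of the random matrix, does not occur on the right.\<close>

lemma tanhc_form_schur_complement: "(cmod (\<Sum>i\<in>UNIV. complex_of_real (tanhc (x i - b)) * c i))\<^sup>2 \<le> tanhc_form x c"
  using add_mono[OF tanhc_schur_complement[of x b "\<lambda>i. Re (c i)"] tanhc_schur_complement[of x b "\<lambda>i. Im (c i)"]]
  unfolding tanhc_form_eq cmod_power2 by simp

text \<open>Parallelogram identity: the gap between the two sides is the form at
  \<open>(c - d) / 2\<close>, which is nonnegative.\<close>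

lemma tanhc_form_midpoint: "tanhc_form x (\<lambda>i. (c i + d i) / 2) \<le> tanhc_form x c / 2 + tanhc_form x d / 2"
proof -
  have "tanhc_form x c / 2 + tanhc_form x d / 2 - tanhc_form x (\<lambda>i. (c i + d i) / 2) = tanhc_form x (\<lambda>i. (c i - d i) / 2)"
    unfolding tanhc_form_def Re_sum sum_divide_distrib sum.distrib[symmetric] sum_subtractf[symmetric]
    by (intro sum.cong refl) (simp add: field_simps)
  then show ?thesis using tanhc_form_nonneg[of x "\<lambda>i. (c i - d i) / 2"] by linarith
qed

subsection \<open>Hermitian matrices and their spectral decompositions\<close>

definition hinner :: "complex^'n \<Rightarrow> complex^'n \<Rightarrow> complex" where
  "hinner x y = (\<Sum>k\<in>UNIV. x $ k * cnj (y $ k))"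

lemma hinner_add_left: "hinner (x + y) z = hinner x z + hinner y z"
  and hinner_diff_left: "hinner (x - y) z = hinner x z - hinner y z"
  and hinner_scale_left: "hinner (a *s x) z = a * hinner x z"
  and hinner_zero_left [simp]: "hinner 0 z = 0"
  by (simp_all add: hinner_def algebra_simps sum.distrib sum_subtractf sum_distrib_left)

lemma cnj_hinner: "cnj (hinner x y) = hinner y x"
  by (simp add: hinner_def mult.commute)

lemma hinner_scale_right: "hinner z (a *s x) = cnj a * hinner z x"
  by (simp add: hinner_def algebra_simps sum_distrib_left)

lemma hinner_sum_left: "hinner (\<Sum>i\<in>I. g i) z = (\<Sum>i\<in>I. hinner (g i) z)"
  unfolding hinner_def sum_component sum_distrib_right by (rule sum.swap)

lemma Re_hinner: "Re (hinner x y) = inner x y"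
  by (simp add: hinner_def inner_vec_def inner_complex_def)

lemma hinner_self: "hinner x x = complex_of_real ((norm x)\<^sup>2)"
proof (rule complex_eqI)
  show "Re (hinner x x) = Re (complex_of_real ((norm x)\<^sup>2))"
    by (simp add: Re_hinner power2_norm_eq_inner)
  show "Im (hinner x x) = Im (complex_of_real ((norm x)\<^sup>2))"
    by (simp add: hinner_def mult.commute)
qed

lemma Im_hinner: "Im (hinner x y) = inner x (\<i> *s y)"
  unfolding Re_hinner[symmetric] hinner_scale_right by simp

lemma orthonormal_hinner: "orthonormal v \<longleftrightarrow> (\<forall>i j. hinner (v i) (v j) = (if i = j then 1 else 0))"
  by (simp add: orthonormal_def hinner_def)

lemma hinner_matrix_vector_left:
  assumes "hermitian M"
  shows "hinner (M *v x) y = hinner x (M *v y)"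
proof -
  have "hinner (M *v x) y = (\<Sum>i\<in>UNIV. \<Sum>j\<in>UNIV. M $ i $ j * x $ j * cnj (y $ i))"
    by (simp add: hinner_def matrix_vector_mult_def sum_distrib_right)
  also have "\<dots> = (\<Sum>j\<in>UNIV. \<Sum>i\<in>UNIV. M $ i $ j * x $ j * cnj (y $ i))"
    by (rule sum.swap)
  also have "\<dots> = (\<Sum>j\<in>UNIV. \<Sum>i\<in>UNIV. x $ j * cnj (M $ j $ i * y $ i))"
  proof (intro sum.cong refl)
    fix i j
    have "M $ i $ j = cnj (M $ j $ i)" using assms unfolding hermitian_def by blast
    then show "M $ i $ j * x $ j * cnj (y $ i) = x $ j * cnj (M $ j $ i * y $ i)" by simp
  qed
  also have "\<dots> = hinner x (M *v y)"
    by (simp add: hinner_def matrix_vector_mult_def sum_distrib_left)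
  finally show ?thesis .
qed

lemma rank_one_mult: "rank_one v *v x = hinner x v *s v"
  by (simp add: vec_eq_iff rank_one_def matrix_vector_mult_def hinner_def sum_distrib_left mult_ac)

lemma scaleR_matrix_vector_mult: "(a *\<^sub>R M) *v x = a *\<^sub>R (M *v (x :: complex^'n))"
  by (simp add: vec_eq_iff matrix_vector_mult_def scaleR_sum_right)

lemma sum_scaleR_matrix_vector_mult:
  "(\<Sum>i\<in>I. g i *\<^sub>R N i) *v x = (\<Sum>i\<in>I. g i *\<^sub>R (N i *v (x :: complex^'n)))"
proof (induction I rule: infinite_finite_induct)
  case (insert i I)
  then show ?case by (simp add: matrix_vector_mult_add_rdistrib scaleR_matrix_vector_mult)
qed auto

text \<open>With the vectors as rows of \<open>V\<close>, orthonormality says that the conjugate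
  transpose \<open>W\<close> is a right inverse of \<open>V\<close>. For square matrices it is then
  also a left inverse, which is completeness.\<close>

lemma orthonormal_expansion:
  fixes x :: "complex^'n::finite"
  assumes "orthonormal v"
  shows "x = (\<Sum>i\<in>UNIV. hinner x (v i) *s v i)"
proof -
  define V :: "complex^'n^'n" where "V = (\<chi> i k. v i $ k)"
  define W :: "complex^'n^'n" where "W = (\<chi> k i. cnj (v i $ k))"
  have "V ** W = mat 1"
    using assms by (simp add: V_def W_def matrix_matrix_mult_def mat_def vec_eq_iff orthonormal_def)
  then have "W ** V = mat 1" by (simp add: matrix_left_right_inverse)
  then have WV: "(\<Sum>i\<in>UNIV. cnj (v i $ r) * v i $ s) = (if r = s then 1 else 0)" for r s
    by (simp add: V_def W_def matrix_matrix_mult_def mat_def vec_eq_iff)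
  show ?thesis
  proof (subst vec_eq_iff, rule allI)
    fix s
    have "(\<Sum>i\<in>UNIV. hinner x (v i) *s v i) $ s = (\<Sum>i\<in>UNIV. \<Sum>r\<in>UNIV. x $ r * (cnj (v i $ r) * v i $ s))"
      by (simp add: hinner_def sum_distrib_left mult_ac)
    also have "\<dots> = (\<Sum>r\<in>UNIV. x $ r * (\<Sum>i\<in>UNIV. cnj (v i $ r) * v i $ s))"
      by (subst sum.swap) (simp add: sum_distrib_left)
    also have "\<dots> = x $ s" unfolding WV by (simp add: if_distrib cong: if_cong)
    finally show "x $ s = (\<Sum>i\<in>UNIV. hinner x (v i) *s v i) $ s" by simp
  qed
qed

lemma parseval:
  assumes "orthonormal v"
  shows "hinner x y = (\<Sum>i\<in>UNIV. hinner x (v i) * hinner (v i) y)"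
proof -
  have "hinner x y = hinner (\<Sum>i\<in>UNIV. hinner x (v i) *s v i) y"
    by (rule arg_cong[OF orthonormal_expansion[OF assms]])
  then show ?thesis by (simp add: hinner_sum_left hinner_scale_left)
qed

lemma parseval_norm:
  assumes "orthonormal v"
  shows "(norm x)\<^sup>2 = (\<Sum>i\<in>UNIV. (cmod (hinner x (v i)))\<^sup>2)"
proof -
  have "complex_of_real ((norm x)\<^sup>2) = (\<Sum>i\<in>UNIV. hinner x (v i) * cnj (hinner x (v i)))"
    unfolding hinner_self[symmetric] by (subst parseval[OF assms]) (simp add: cnj_hinner)
  also have "\<dots> = complex_of_real (\<Sum>i\<in>UNIV. (cmod (hinner x (v i)))\<^sup>2)"
    by (simp flip: complex_norm_square)
  finally show ?thesis by (simp only: of_real_eq_iff)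
qed

lemma matrix_vector_mult_sum_right:
  "M *v (\<Sum>i\<in>I. g i) = (\<Sum>i\<in>I. M *v (g i :: 'a::comm_semiring_1^'n))"
  by (induction I rule: infinite_finite_induct) (auto simp: matrix_vector_right_distrib)

lemma matrix_eq_on_orthonormal:
  fixes M N :: "complex^'n::finite^'n"
  assumes "orthonormal v" "\<And>i. M *v v i = N *v v i"
  shows "M = N"
proof -
  have "L *v x = (\<Sum>i\<in>UNIV. hinner x (v i) *s (L *v v i))" for L :: "complex^'n^'n" and x
    using arg_cong[OF orthonormal_expansion[OF assms(1), of x], of "\<lambda>y. L *v y"]
    by (simp only: matrix_vector_mult_sum_right vector_scalar_commute)
  then have "M *v x = N *v x" for x by (metis (no_types, lifting) assms(2) sum.cong)
  then show ?thesis by (simp add: matrix_eq)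
qed

lemma mult_orthonormal_sum:
  assumes "orthonormal v"
  shows "(\<Sum>i\<in>UNIV. g i *\<^sub>R rank_one (v i)) *v v j = g j *\<^sub>R v j"
proof -
  have "(\<Sum>i\<in>UNIV. g i *\<^sub>R rank_one (v i)) *v v j = (\<Sum>i\<in>UNIV. if i = j then g j *\<^sub>R v j else 0)"
    using assms unfolding sum_scaleR_matrix_vector_mult orthonormal_hinner
    by (intro sum.cong) (auto simp: rank_one_mult)
  then show ?thesis by simp
qed

lemma spectral_decomposition_eigenvector:
  "spectral_decomposition M lam v \<Longrightarrow> M *v v j = lam j *\<^sub>R v j"
  by (auto simp: spectral_decomposition_def mult_orthonormal_sum)

lemma scaleR_eq_scale: "a *\<^sub>R (x :: complex^'n) = complex_of_real a *s x"
  by (simp add: vec_eq_iff scaleR_conv_of_real[where 'a=complex])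

lemma spectral_decompositionI:
  assumes "orthonormal v" "\<And>i. M *v v i = lam i *\<^sub>R v i"
  shows "spectral_decomposition M lam v"
  unfolding spectral_decomposition_def
proof (rule conjI[OF assms(1)], rule matrix_eq_on_orthonormal[OF assms(1)])
  show "M *v v i = (\<Sum>i\<in>UNIV. lam i *\<^sub>R rank_one (v i)) *v v i" for i
    by (simp only: assms mult_orthonormal_sum)
qed

lemma spectral_decomposition_hermitian:
  "spectral_decomposition M lam v \<Longrightarrow> hermitian M"
  by (simp add: spectral_decomposition_def hermitian_def rank_one_def mult.commute)

lemma spectral_decomposition_hinner:
  assumes "spectral_decomposition M lam v"
  shows "hinner (M *v x) (v i) = lam i * hinner x (v i)"
  using hinner_matrix_vector_left[OF spectral_decomposition_hermitian[OF assms], of x "v i"]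
  by (simp add: spectral_decomposition_eigenvector[OF assms] scaleR_eq_scale hinner_scale_right)

section \<open>Functions of a Hermitian matrix\<close>

text \<open>Eigenvectors for distinct eigenvalues are orthogonal, so \<open>lam i = mu j\<close>
  whenever \<open>v i\<close> and \<open>w j\<close> overlap, and the values of \<open>f\<close>
  agree there too. This justifies the definite description in \<open>matrix_fun\<close>.\<close>

lemma spectral_decomposition_fun_unique:
  assumes M: "spectral_decomposition M lam v" and M': "spectral_decomposition M mu w"
  shows "(\<Sum>i\<in>UNIV. f (lam i) *\<^sub>R rank_one (v i)) = (\<Sum>i\<in>UNIV. f (mu i) *\<^sub>R rank_one (w i))"
proof (rule matrix_eq_on_orthonormal)
  show v: "orthonormal v" using M by (simp add: spectral_decomposition_def)
  fix i
  have w: "orthonormal w" using M' by (simp add: spectral_decomposition_def)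
  have coeff: "complex_of_real (f (mu j)) * hinner (v i) (w j) = complex_of_real (f (lam i)) * hinner (v i) (w j)" for j
  proof -
    have "complex_of_real (lam i) * hinner (v i) (w j) = mu j * hinner (v i) (w j)"
      using spectral_decomposition_hinner[OF M', of "v i" j]
      by (simp add: spectral_decomposition_eigenvector[OF M] scaleR_eq_scale hinner_scale_left)
    then have "lam i = mu j \<or> hinner (v i) (w j) = 0" by auto
    then show ?thesis by auto
  qed
  have "(\<Sum>j\<in>UNIV. f (mu j) *\<^sub>R rank_one (w j)) *v v i = (\<Sum>j\<in>UNIV. complex_of_real (f (lam i)) *s (hinner (v i) (w j) *s w j))"
    unfolding sum_scaleR_matrix_vector_mult rank_one_mult
    by (intro sum.cong refl) (simp add: scaleR_eq_scale coeff)
  also have "\<dots> = complex_of_real (f (lam i)) *s v i"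
    by (simp only: vec.scale_sum_right[symmetric] orthonormal_expansion[OF w, symmetric])
  finally show "(\<Sum>j\<in>UNIV. f (lam j) *\<^sub>R rank_one (v j)) *v v i = (\<Sum>j\<in>UNIV. f (mu j) *\<^sub>R rank_one (w j)) *v v i"
    by (simp add: mult_orthonormal_sum[OF v] scaleR_eq_scale)
qed

lemma matrix_fun_spectral:
  assumes "spectral_decomposition M lam v"
  shows "matrix_fun f M = (\<Sum>i\<in>UNIV. f (lam i) *\<^sub>R rank_one (v i))"
  unfolding matrix_fun_def
proof (rule the_equality)
  show "\<exists>lam' v'. spectral_decomposition M lam' v' \<and>
      (\<Sum>i\<in>UNIV. f (lam i) *\<^sub>R rank_one (v i)) = (\<Sum>i\<in>UNIV. f (lam' i) *\<^sub>R rank_one (v' i))"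
    using assms by blast
next
  fix N
  assume "\<exists>mu w. spectral_decomposition M mu w \<and> N = (\<Sum>i\<in>UNIV. f (mu i) *\<^sub>R rank_one (w i))"
  then obtain mu w where w: "spectral_decomposition M mu w"
    and N: "N = (\<Sum>i\<in>UNIV. f (mu i) *\<^sub>R rank_one (w i))" by blast
  show "N = (\<Sum>i\<in>UNIV. f (lam i) *\<^sub>R rank_one (v i))"
    unfolding N by (rule spectral_decomposition_fun_unique[OF w assms])
qed

lemma matrix_fun_spectral_decomposition:
  assumes "spectral_decomposition M lam v"
  shows "spectral_decomposition (matrix_fun f M) (\<lambda>i. f (lam i)) v"
  using assms matrix_fun_spectral[OF assms, of f] by (simp add: spectral_decomposition_def)

lemma trace_fun_spectral:
  assumes "spectral_decomposition M lam v"
  shows "trace_fun f M = (\<Sum>i\<in>UNIV. f (lam i))"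
proof -
  have "hinner (v i) (v i) = 1" for i
    using assms by (simp add: spectral_decomposition_def orthonormal_hinner)
  then have *: "(\<Sum>k\<in>UNIV. Re (v i $ k * cnj (v i $ k))) = 1" for i
    unfolding hinner_def by (metis Re_sum one_complex.sel(1))
  have "trace_fun f M = (\<Sum>k\<in>UNIV. \<Sum>i\<in>UNIV. f (lam i) * Re (v i $ k * cnj (v i $ k)))"
    by (simp add: trace_fun_def trace_def matrix_fun_spectral[OF assms] rank_one_def)
  also have "\<dots> = (\<Sum>i\<in>UNIV. f (lam i) * (\<Sum>k\<in>UNIV. Re (v i $ k * cnj (v i $ k))))"
    by (subst sum.swap) (simp add: sum_distrib_left)
  finally show ?thesis by (simp only: * mult_1_right)
qed

section \<open>Existence of spectral decompositions\<close>

lemma continuous_on_matrix_vector_mult [continuous_intros]: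
  fixes M :: "complex^'n^'m"
  assumes "continuous_on S g"
  shows "continuous_on S (\<lambda>x. M *v g x)"
  unfolding matrix_vector_mult_def using assms
  by (intro continuous_on_vec_lambda continuous_intros)

lemma continuous_on_hinner [continuous_intros]:
  assumes "continuous_on S g" "continuous_on S h"
  shows "continuous_on S (\<lambda>x. hinner (g x) (h x))"
  unfolding hinner_def using assms by (intro continuous_intros)

lemma inner_matrix_vector_left:
  "hermitian M \<Longrightarrow> inner (M *v x) y = inner x (M *v y)"
  by (simp add: hinner_matrix_vector_left flip: Re_hinner)

lemma exists_unit_hinner_orthogonal:
  fixes S :: "(complex^'n::finite) set"
  assumes "finite S" "card S < CARD('n)"
  shows "\<exists>x. norm x = 1 \<and> (\<forall>s\<in>S. hinner x s = 0)"
proof -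
  \<comment> \<open>Complex orthogonality to \<open>s\<close> is real orthogonality to both
    \<open>s\<close> and \<open>\<i> *s s\<close>. Doubling the set is harmless because the real
    dimension of the space is also \<open>2 * CARD('n)\<close>.\<close>
  define T where "T = S \<union> (\<lambda>s. \<i> *s s) ` S"
  have "card T \<le> card S + card ((\<lambda>s. \<i> *s s) ` S)" unfolding T_def by (rule card_Un_le)
  also have "\<dots> \<le> 2 * card S" using card_image_le[OF assms(1), of "\<lambda>s. \<i> *s s"] by simp
  finally have "dim T < DIM(complex^'n)"
    using dim_le_card'[of T] assms by (simp add: T_def)
  then obtain x where x: "x \<noteq> 0" "\<And>y. y \<in> span T \<Longrightarrow> orthogonal x y"
    using orthogonal_to_subspace_exists by metis
  have x0: "hinner x s = 0" if "s \<in> S" for s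
  proof (rule complex_eqI)
    have "orthogonal x s" "orthogonal x (\<i> *s s)"
      using that by (auto intro!: x(2) span_base simp: T_def)
    then show "Re (hinner x s) = Re 0" "Im (hinner x s) = Im 0"
      by (simp_all add: Re_hinner Im_hinner orthogonal_def)
  qed
  show ?thesis
  proof (intro exI conjI ballI)
    show "norm (inverse (norm x) *\<^sub>R x) = 1" using x(1) by simp
    show "hinner (inverse (norm x) *\<^sub>R x) s = 0" if "s \<in> S" for s
      using x0[OF that] by (simp add: scaleR_eq_scale hinner_scale_left)
  qed
qed

text \<open>The orthogonal complement \<open>W\<close> of known eigenvectors is invariant under
  \<open>M\<close>. By compactness the Rayleigh quotient attains its maximum on the unit sphere of
  \<open>W\<close>, and a maximiser is an eigenvector.\<close>

lemma hermitian_eigenvector_orthogonal: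
  fixes M :: "complex^'n::finite^'n"
  assumes M: "hermitian M" and S: "finite S" "card S < CARD('n)"
    and ev: "\<And>s. s \<in> S \<Longrightarrow> \<exists>l. M *v s = l *\<^sub>R s"
  shows "\<exists>x l. norm x = 1 \<and> (\<forall>s\<in>S. hinner x s = 0) \<and> M *v x = l *\<^sub>R x"
proof -
  define W where "W = {x. \<forall>s\<in>S. hinner x s = 0}"
  have "closed W"
    unfolding W_def Ball_def by (intro closed_Collect_all closed_Collect_imp closed_Collect_eq continuous_intros) auto
  then have "compact (W \<inter> sphere 0 1)" by (intro closed_Int_compact) auto
  moreover have "W \<inter> sphere 0 1 \<noteq> {}"
    using exists_unit_hinner_orthogonal[OF S] by (auto simp: W_def)
  moreover have "continuous_on (W \<inter> sphere 0 1) (\<lambda>x. inner (M *v x) x)"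
    by (intro continuous_intros)
  ultimately have "\<exists>z\<in>W \<inter> sphere 0 1. \<forall>x\<in>W \<inter> sphere 0 1. inner (M *v x) x \<le> inner (M *v z) z"
    by (rule continuous_attains_sup)
  then obtain z where z: "z \<in> W" "norm z = 1"
    and max: "\<forall>x\<in>W \<inter> sphere 0 1. inner (M *v x) x \<le> inner (M *v z) z"
    by auto
  define l where "l = inner (M *v z) z"
  have W_lin: "x + t *\<^sub>R y \<in> W" if "x \<in> W" "y \<in> W" for x y t
    using that by (simp add: W_def scaleR_eq_scale hinner_add_left hinner_scale_left)
  have W_M: "M *v x \<in> W" if "x \<in> W" for x
    unfolding W_def
  proof safe
    fix s assume s: "s \<in> S"
    obtain k where "M *v s = k *\<^sub>R s" using ev[OF s] by blast
    then show "hinner (M *v x) s = 0"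
      using that s by (simp add: hinner_matrix_vector_left[OF M] scaleR_eq_scale hinner_scale_right W_def)
  qed
  \<comment> \<open>Maximality on the unit sphere extends to all of \<open>W\<close> by homogeneity,
    so that variations of \<open>z\<close> need not be normalised.\<close>
  have bound: "inner (M *v x) x \<le> l * (norm x)\<^sup>2" if "x \<in> W" for x
  proof (cases "x = 0")
    case False
    have "0 \<in> W" by (simp add: W_def)
    define y where "y = inverse (norm x) *\<^sub>R x"
    have "y \<in> W" "norm y = 1"
      using W_lin[OF \<open>0 \<in> W\<close> that, of "inverse (norm x)"] False by (simp_all add: y_def)
    then have "inner (M *v y) y \<le> l" using max by (simp add: l_def)
    moreover have xy: "x = norm x *\<^sub>R y" using False by (simp add: y_def)
    then have "M *v x = norm x *\<^sub>R (M *v y)" by (metis scaleR_eq_scale vector_scalar_commute)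
    from arg_cong2[OF this xy, of inner] have "inner (M *v x) x = (norm x)\<^sup>2 * inner (M *v y) y"
      by (simp add: power2_eq_square)
    ultimately show ?thesis
      using mult_left_mono[of "inner (M *v y) y" l "(norm x)\<^sup>2"] by (simp add: mult.commute)
  qed simp
  define r where "r = M *v z - l *\<^sub>R z"
  have rW: "r \<in> W" using W_lin[OF W_M[OF z(1)] z(1), of "- l"] by (simp add: r_def)
  txt \<open>First variation of the Rayleigh quotient at the maximiser \<open>z\<close> in the direction \<open>r\<close>.\<close>
  have lin: "2 * t * (norm r)\<^sup>2 \<le> t\<^sup>2 * (l * (norm r)\<^sup>2 - inner (M *v r) r)" for t
  proof -
    have "M *v (z + t *\<^sub>R r) = M *v z + t *\<^sub>R (M *v r)"
      by (simp add: matrix_vector_right_distrib scaleR_eq_scale vector_scalar_commute)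
    moreover have "inner (M *v r) z = inner (M *v z) r"
      by (metis inner_matrix_vector_left[OF M] inner_commute)
    ultimately have "l + 2 * t * inner (M *v z) r + t\<^sup>2 * inner (M *v r) r \<le> l * (norm (z + t *\<^sub>R r))\<^sup>2"
      using bound[OF W_lin[OF z(1) rW, of t]]
      by (simp add: inner_add_left inner_add_right l_def[symmetric] power2_eq_square distrib_left)
    also have "(norm (z + t *\<^sub>R r))\<^sup>2 = 1 + 2 * t * inner z r + t\<^sup>2 * (norm r)\<^sup>2"
      using z(2) unfolding power2_norm_eq_inner norm_eq_1
      by (simp add: inner_add_left inner_add_right inner_commute[of r z] power2_eq_square distrib_left)
    finally have "2 * t * (inner (M *v z) r - l * inner z r) \<le> t\<^sup>2 * (l * (norm r)\<^sup>2 - inner (M *v r) r)"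
      by (simp add: algebra_simps)
    moreover have "inner (M *v z) r - l * inner z r = (norm r)\<^sup>2"
      by (simp add: r_def power2_norm_eq_inner inner_diff_left)
    ultimately show ?thesis by simp
  qed
  have "r = 0"
  proof (rule ccontr)
    assume "r \<noteq> 0"
    define C where "C = l * (norm r)\<^sup>2 - inner (M *v r) r"
    have C: "C \<ge> 0" using bound[OF rW] by (simp add: C_def)
    \<comment> \<open>Dividing \<open>lin\<close> by this \<open>t\<close> bounds
      \<open>2 * (norm r)\<^sup>2\<close> by \<open>t * C\<close>, hence by
      \<open>t * (C + 1) = (norm r)\<^sup>2\<close>. The summand 1 keeps the denominator positive
      when \<open>C = 0\<close>.\<close>
    define t where "t = (norm r)\<^sup>2 / (C + 1)"
    have n: "(norm r)\<^sup>2 > 0" using \<open>r \<noteq> 0\<close> by simp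
    have t: "t > 0" using C n by (simp add: t_def)
    have "t * (2 * (norm r)\<^sup>2) \<le> t * (t * C)" using lin[of t] by (simp add: C_def power2_eq_square mult_ac)
    then have "2 * (norm r)\<^sup>2 \<le> t * C" using t by simp
    also have "\<dots> \<le> t * (C + 1)" using t by simp
    also have "\<dots> = (norm r)\<^sup>2" using C by (simp add: t_def)
    finally show False using n by simp
  qed
  then show ?thesis using z unfolding W_def r_def by (intro exI[of _ z] exI[of _ l]) auto
qed

text \<open>Orthonormal eigenvectors are collected one at a time until there are
  \<open>CARD('n)\<close> of them; a bijection then indexes them by \<open>'n\<close>.\<close>

lemma hermitian_spectral_decomposition:
  fixes M :: "complex^'n::finite^'n"
  assumes M: "hermitian M"
  obtains lam v where "spectral_decomposition M lam v"
proof -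
  have "k \<le> CARD('n) \<Longrightarrow> \<exists>S. finite S \<and> card S = k \<and>
     (\<forall>s\<in>S. norm s = 1 \<and> (\<exists>l. M *v s = l *\<^sub>R s)) \<and> (\<forall>s\<in>S. \<forall>t\<in>S. s \<noteq> t \<longrightarrow> hinner s t = 0)" for k
  proof (induction k)
    case (Suc k)
    then obtain S where S: "finite S" "card S = k" "\<And>s. s \<in> S \<Longrightarrow> norm s = 1"
      "\<And>s. s \<in> S \<Longrightarrow> \<exists>l. M *v s = l *\<^sub>R s" "\<And>s t. s \<in> S \<Longrightarrow> t \<in> S \<Longrightarrow> s \<noteq> t \<Longrightarrow> hinner s t = 0"
      by auto
    have "card S < CARD('n)" using S(2) Suc.prems by simp
    then obtain x l where x: "norm x = 1" "\<And>s. s \<in> S \<Longrightarrow> hinner x s = 0" "M *v x = l *\<^sub>R x"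
      using hermitian_eigenvector_orthogonal[OF M S(1) _ S(4)] by blast
    have x': "hinner s x = 0" if "s \<in> S" for s using x(2)[OF that] cnj_hinner[of x s] by simp
    have "x \<notin> S" using x(1) x(2)[of x] by (auto simp: hinner_self)
    then have "finite (insert x S) \<and> card (insert x S) = Suc k" using S by simp
    moreover have "\<forall>s\<in>insert x S. norm s = 1 \<and> (\<exists>l. M *v s = l *\<^sub>R s)"
      using x S(3,4) by blast
    moreover have "\<forall>s\<in>insert x S. \<forall>t\<in>insert x S. s \<noteq> t \<longrightarrow> hinner s t = 0"
      using x(2) x' S(5) by blast
    ultimately show ?case by blast
  qed (auto intro!: exI[of _ "{}"])
  from this[of "CARD('n)"] obtain S where S: "finite S" "card S = CARD('n)" "\<And>s. s \<in> S \<Longrightarrow> norm s = 1"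
      "\<And>s. s \<in> S \<Longrightarrow> \<exists>l. M *v s = l *\<^sub>R s" "\<And>s t. s \<in> S \<Longrightarrow> t \<in> S \<Longrightarrow> s \<noteq> t \<Longrightarrow> hinner s t = 0"
    by auto
  obtain v where v: "bij_betw v (UNIV :: 'n set) S"
    using finite_same_card_bij[OF finite_class.finite_UNIV S(1)] S(2) by auto
  then have vS: "v i \<in> S" and inj: "v i = v j \<longleftrightarrow> i = j" for i j
    by (auto simp: bij_betw_def inj_on_def)
  have "\<exists>l. M *v v i = l *\<^sub>R v i" for i using S(4) vS by blast
  then obtain lam where "\<And>i. M *v v i = lam i *\<^sub>R v i" by metis
  moreover have "orthonormal v"
    unfolding orthonormal_hinner using S(3,5) vS inj by (auto simp: hinner_self)
  ultimately show ?thesis using that spectral_decompositionI by blast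
qed

subsection \<open>The trace inequality\<close>

text \<open>Summing over \<open>k\<close> first leaves only the diagonal terms \<open>j = l\<close>,
  where the kernel is 1. Both the row sums and the column sums of the doubly stochastic weights come
  from this identity.\<close>

lemma tanhc_form_sum_orthonormal:
  fixes g :: "'i::finite \<Rightarrow> 'k::finite \<Rightarrow> complex"
  assumes "\<And>j l. (\<Sum>k\<in>UNIV. g j k * cnj (g l k)) = (if j = l then 1 else 0)"
  shows "(\<Sum>k\<in>UNIV. tanhc_form a (\<lambda>j. x j * g j k)) = (\<Sum>j\<in>UNIV. (cmod (x j))\<^sup>2)"
proof -
  have "(\<Sum>k\<in>UNIV. tanhc_form a (\<lambda>j. x j * g j k)) =
      Re (\<Sum>k\<in>UNIV. \<Sum>j\<in>UNIV. \<Sum>l\<in>UNIV. complex_of_real (tanhc (a j - a l)) * (x j * g j k) * cnj (x l * g l k))"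
    by (simp only: tanhc_form_def Re_sum)
  also have "\<dots> = Re (\<Sum>j\<in>UNIV. \<Sum>l\<in>UNIV. \<Sum>k\<in>UNIV. complex_of_real (tanhc (a j - a l)) * (x j * g j k) * cnj (x l * g l k))"
    by (subst sum.swap, subst sum.swap) (rule refl)
  also have "\<dots> = Re (\<Sum>j\<in>UNIV. \<Sum>l\<in>UNIV. complex_of_real (tanhc (a j - a l)) * x j * cnj (x l) * (\<Sum>k\<in>UNIV. g j k * cnj (g l k)))"
    by (simp add: sum_distrib_left mult_ac)
  also have "\<dots> = Re (\<Sum>j\<in>UNIV. x j * cnj (x j))"
    by (simp add: assms if_distrib cong: if_cong)
  finally show ?thesis by (simp add: cmod_power2 flip: power2_eq_square)
qed

text \<open>This is the quadratic form of \<Phi>(M) at \<open>x\<close>, written in coordinates of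
  the basis \<open>e\<close>; the matrix \<Phi>(M) itself is never formed.\<close>

definition tanhc_quad ::
    "('n \<Rightarrow> real) \<Rightarrow> ('n \<Rightarrow> complex^'n) \<Rightarrow> complex^'n^'n \<Rightarrow> complex^'n::finite \<Rightarrow> real" where
  "tanhc_quad a e M x = Re (\<Sum>j\<in>UNIV. \<Sum>l\<in>UNIV. complex_of_real (tanhc (a j - a l)) *
     (hinner x (e j) * cnj (hinner x (e l)) * hinner (M *v e j) (e l)))"

text \<open>The hypothesis writes \<open>M\<close> as a weighted sum of rank-one matrices, on each
  of which \<Phi> yields a \<open>tanhc_form\<close>. The weights are 1 for Gram matrices and the
  eigenvalues for a spectral decomposition.\<close>

lemma tanhc_quad_eq_sum_tanhc_form:
  assumes "\<And>j l. hinner (M *v e j) (e l) = (\<Sum>k\<in>UNIV. complex_of_real (m k) * (g j k * cnj (g l k)))"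
  shows "tanhc_quad a e M x = (\<Sum>k\<in>UNIV. m k * tanhc_form a (\<lambda>j. hinner x (e j) * g j k))"
proof -
  have "tanhc_quad a e M x = Re (\<Sum>j\<in>UNIV. \<Sum>l\<in>UNIV. \<Sum>k\<in>UNIV.
      complex_of_real (m k) * (complex_of_real (tanhc (a j - a l)) * (hinner x (e j) * g j k) * cnj (hinner x (e l) * g l k)))"
    by (simp add: tanhc_quad_def assms sum_distrib_left mult_ac)
  also have "\<dots> = Re (\<Sum>k\<in>UNIV. \<Sum>j\<in>UNIV. \<Sum>l\<in>UNIV.
      complex_of_real (m k) * (complex_of_real (tanhc (a j - a l)) * (hinner x (e j) * g j k) * cnj (hinner x (e l) * g l k)))"
    by (subst (2) sum.swap, subst sum.swap) (rule refl)
  also have "\<dots> = (\<Sum>k\<in>UNIV. m k * tanhc_form a (\<lambda>j. hinner x (e j) * g j k))"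
    unfolding sum_distrib_left[symmetric] by (simp only: tanhc_form_def Re_sum Re_complex_of_real times_complex.sel Im_complex_of_real mult_zero_left diff_zero)
  finally show ?thesis .
qed

lemma spectral_hinner_mult:
  assumes "spectral_decomposition M mu w"
  shows "hinner (M *v x) y = (\<Sum>k\<in>UNIV. complex_of_real (mu k) * (hinner x (w k) * cnj (hinner y (w k))))"
proof -
  have "orthonormal w" using assms by (simp add: spectral_decomposition_def)
  from parseval[OF this, of "M *v x" y] show ?thesis
    by (simp add: spectral_decomposition_hinner[OF assms] cnj_hinner mult_ac)
qed

text \<open>For \<open>u = (a - b) / 2\<close> this is
  \<open>exp (2 * u) - 1 = tanh u * (1 + exp (2 * u))\<close>, multiplied by \<open>exp b\<close>.
  The arithmetic mean of the exponentials is isolated because it splits into the contributions of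
  \<open>exp b\<close> and \<open>exp a\<close>.\<close>

lemma exp_diff_tanhc: "exp a - exp b = tanhc (a - b) * ((exp b + exp a) / 2 * (a - b))"
proof (cases "a = b")
  case False
  define u where "u = (a - b) / 2"
  have u: "u \<noteq> 0" "a = b + 2 * u" using False by (simp_all add: u_def field_simps)
  have "cosh u \<noteq> 0" using cosh_real_pos[of u] by linarith
  have "exp (2 * u) = exp u * exp u" by (simp flip: exp_add)
  have "exp (2 * u) - 1 = exp u * (2 * sinh u)" "1 + exp (2 * u) = exp u * (2 * cosh u)"
    using \<open>exp (2 * u) = exp u * exp u\<close>
    by (simp_all add: sinh_field_def cosh_field_def algebra_simps exp_minus_inverse)
  then have "exp (2 * u) - 1 = tanh u * (1 + exp (2 * u))"
    using \<open>cosh u \<noteq> 0\<close> by (simp add: tanh_def)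
  then have "exp b * (exp (2 * u) - 1) = exp b * (tanh u * (1 + exp (2 * u)))" by simp
  then have "exp a - exp b = tanh u * (exp b + exp a)"
    unfolding u(2) exp_add by algebra
  also have "tanh u = tanhc (a - b) * ((a - b) / 2)" using u by (simp add: tanhc_def)
  finally show ?thesis by (simp add: mult_ac)
qed simp

lemma hermitian_diff: "hermitian M \<Longrightarrow> hermitian N \<Longrightarrow> hermitian (M - N)"
  unfolding hermitian_def vector_minus_component complex_cnj_diff by metis

lemma hermitian_matrix_fun: "spectral_decomposition M lam v \<Longrightarrow> hermitian (matrix_fun f M)"
  using matrix_fun_spectral_decomposition spectral_decomposition_hermitian by blast

lemma spectral_decomposition_scaleR:
  "spectral_decomposition M lam v \<Longrightarrow> spectral_decomposition (c *\<^sub>R M) (\<lambda>i. c * lam i) v"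
  by (auto simp: spectral_decomposition_def scaleR_sum_right)

lemma hinner_sandwich:
  assumes "hermitian H"
  shows "hinner ((H ** N ** H) *v x) y = hinner (N *v (H *v x)) (H *v y)"
  by (simp add: hinner_matrix_vector_left[OF assms] flip: matrix_vector_mul_assoc)

lemma hinner_square:
  assumes "hermitian H"
  shows "hinner ((H ** H) *v x) y = hinner (H *v x) (H *v y)"
  by (simp add: hinner_matrix_vector_left[OF assms] flip: matrix_vector_mul_assoc)

lemma exp_diff_square_le:
  fixes A B :: "complex^'n::finite^'n"
  assumes A: "spectral_decomposition A a e" and B: "spectral_decomposition B b v"
  defines "D \<equiv> A - B" and "T \<equiv> matrix_exp A - matrix_exp B"
  shows "Re (hinner ((T ** T) *v x) x) \<le>
    tanhc_quad a e (D ** matrix_exp (2 *\<^sub>R B) ** D) x / 2 +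
    tanhc_quad a e (matrix_exp A ** (D ** D) ** matrix_exp A) x / 2"
proof -
  txt \<open>\<open>p\<close> and \<open>q\<close> are the matrices of \<open>e\<^sup>B D\<close> and \<open>D e\<^sup>A\<close> with respect to the eigenbases \<open>e\<close> of \<open>A\<close> and \<open>v\<close> of \<open>B\<close>.\<close>
  define h where "h j k = hinner (e j) (v k)" for j k
  define p where "p j k = complex_of_real (exp (b k)) * (complex_of_real (a j - b k) * h j k)" for j k
  define q where "q j k = complex_of_real (exp (a j)) * (complex_of_real (a j - b k) * h j k)" for j k
  have e: "orthonormal e" and v: "orthonormal v" using A B by (auto simp: spectral_decomposition_def)
  have hA: "hermitian (matrix_exp A)" and hB: "hermitian (matrix_exp B)"
    using A B hermitian_matrix_fun by blast+
  have T: "hermitian T" unfolding T_def by (rule hermitian_diff[OF hA hB])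
  have D: "hermitian D" unfolding D_def
    by (rule hermitian_diff[OF spectral_decomposition_hermitian[OF A] spectral_decomposition_hermitian[OF B]])
  note eA = matrix_fun_spectral_decomposition[OF A, of exp]
  note eB = matrix_fun_spectral_decomposition[OF B, of exp]
  \<comment> \<open>With \<open>e\<close> on one side and \<open>v\<close> on the other,
    \<open>A\<close> and \<open>B\<close> act by the scalars \<open>a j\<close> and
    \<open>b k\<close>, although they need not commute.\<close>
  have De: "hinner (D *v e j) (v k) = complex_of_real (a j - b k) * h j k" for j k
    by (simp add: D_def matrix_vector_mult_diff_rdistrib hinner_diff_left spectral_decomposition_hinner[OF B]
      spectral_decomposition_eigenvector[OF A] scaleR_eq_scale hinner_scale_left h_def algebra_simps)
  have Te: "hinner (T *v e j) (v k) = complex_of_real (tanhc (a j - b k)) * ((p j k + q j k) / 2)" for j k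
  proof -
    have "hinner (T *v e j) (v k) = complex_of_real (exp (a j) - exp (b k)) * h j k"
      by (simp add: T_def matrix_vector_mult_diff_rdistrib hinner_diff_left spectral_decomposition_hinner[OF eB]
        spectral_decomposition_eigenvector[OF eA] scaleR_eq_scale hinner_scale_left h_def algebra_simps)
    also have "\<dots> = complex_of_real (tanhc (a j - b k)) * ((p j k + q j k) / 2)"
      unfolding exp_diff_tanhc p_def q_def by (simp add: field_simps)
    finally show ?thesis .
  qed
  have Tx: "hinner (T *v x) (v k) = (\<Sum>j\<in>UNIV. complex_of_real (tanhc (a j - b k)) *
      ((hinner x (e j) * p j k + hinner x (e j) * q j k) / 2))" for k
  proof -
    have "hinner (T *v x) (v k) = (\<Sum>j\<in>UNIV. hinner x (e j) * hinner (T *v e j) (v k))"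
      unfolding hinner_matrix_vector_left[OF T] by (rule parseval[OF e])
    also have "\<dots> = (\<Sum>j\<in>UNIV. complex_of_real (tanhc (a j - b k)) *
      ((hinner x (e j) * p j k + hinner x (e j) * q j k) / 2))"
      unfolding Te by (intro sum.cong refl) (simp add: field_simps)
    finally show ?thesis .
  qed
  \<comment> \<open>The matrix is the product of the adjoint of \<open>matrix_exp B ** D\<close>
    with \<open>matrix_exp B ** D\<close>, so its entries are Gram sums of \<open>p\<close>. The
    same holds below for \<open>D ** matrix_exp A\<close> and \<open>q\<close>.\<close>
  have M1: "tanhc_quad a e (D ** matrix_exp (2 *\<^sub>R B) ** D) x = (\<Sum>k\<in>UNIV. 1 * tanhc_form a (\<lambda>j. hinner x (e j) * p j k))"
  proof (rule tanhc_quad_eq_sum_tanhc_form)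
    fix j l
    have "exp (2 * b k) = exp (b k) * exp (b k)" for k by (simp flip: exp_add)
    then show "hinner ((D ** matrix_exp (2 *\<^sub>R B) ** D) *v e j) (e l) =
        (\<Sum>k\<in>UNIV. complex_of_real 1 * (p j k * cnj (p l k)))"
      unfolding hinner_sandwich[OF D] 
        spectral_hinner_mult[OF matrix_fun_spectral_decomposition[OF spectral_decomposition_scaleR[OF B]]] De p_def
      by (intro sum.cong refl) (simp add: mult_ac)
  qed
  have M2: "tanhc_quad a e (matrix_exp A ** (D ** D) ** matrix_exp A) x = (\<Sum>k\<in>UNIV. 1 * tanhc_form a (\<lambda>j. hinner x (e j) * q j k))"
  proof (rule tanhc_quad_eq_sum_tanhc_form)
    fix j l
    have *: "hinner (D *v (matrix_exp A *v e j)) (v k) = q j k" for j k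
      unfolding spectral_decomposition_eigenvector[OF eA]
      by (simp add: scaleR_eq_scale vector_scalar_commute hinner_scale_left De q_def)
    show "hinner ((matrix_exp A ** (D ** D) ** matrix_exp A) *v e j) (e l) =
        (\<Sum>k\<in>UNIV. complex_of_real 1 * (q j k * cnj (q l k)))"
      unfolding hinner_sandwich[OF hA] hinner_square[OF D]
      by (subst parseval[OF v]) (simp add: * flip: cnj_hinner[of _ "v _"])
  qed
  have "Re (hinner ((T ** T) *v x) x) = (norm (T *v x))\<^sup>2"
    by (simp add: hinner_square[OF T] hinner_self)
  also have "\<dots> = (\<Sum>k\<in>UNIV. (cmod (hinner (T *v x) (v k)))\<^sup>2)"
    by (rule parseval_norm[OF v])
  \<comment> \<open>For each \<open>k\<close> the Schur complement is applied with
    \<open>b k\<close> as the adjoined point; only \<open>p\<close> and \<open>q\<close> depend on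
    \<open>B\<close> afterwards.\<close>
  also have "\<dots> \<le> (\<Sum>k\<in>UNIV. tanhc_form a (\<lambda>j. (hinner x (e j) * p j k + hinner x (e j) * q j k) / 2))"
    unfolding Tx by (intro sum_mono tanhc_form_schur_complement)
  also have "\<dots> \<le> (\<Sum>k\<in>UNIV. tanhc_form a (\<lambda>j. hinner x (e j) * p j k) / 2 + tanhc_form a (\<lambda>j. hinner x (e j) * q j k) / 2)"
    by (intro sum_mono tanhc_form_midpoint)
  also have "\<dots> = tanhc_quad a e (D ** matrix_exp (2 *\<^sub>R B) ** D) x / 2 +
    tanhc_quad a e (matrix_exp A ** (D ** D) ** matrix_exp A) x / 2"
    unfolding M1 M2 by (simp add: sum.distrib sum_divide_distrib)
  finally show ?thesis .
qed

section \<open>From quadratic forms to traces\<close>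

text \<open>At an eigenvector of \<open>L\<close>, \<open>le\<close> bounds the eigenvalue by the
  mean of two convex combinations, one of eigenvalues of \<open>M\<close> and one of eigenvalues of
  \<open>N\<close>. Monotonicity and Jensen's inequality carry this over to \<open>f\<close>;
  summation over an eigenbasis of \<open>L\<close> restores the traces because the columns of
  weights sum to 1.\<close>

lemma trace_fun_le_if_quad_le:
  fixes M N L :: "complex^'n::finite^'n"
  assumes e: "orthonormal e"
    and L: "hermitian L" "\<And>x. 0 \<le> Re (hinner (L *v x) x)"
    and M: "hermitian M" "\<And>x. 0 \<le> Re (hinner (M *v x) x)"
    and N: "hermitian N" "\<And>x. 0 \<le> Re (hinner (N *v x) x)"
    and le: "\<And>x. Re (hinner (L *v x) x) \<le> tanhc_quad a e M x / 2 + tanhc_quad a e N x / 2"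
    and f: "mono_on {0..} f" "convex_on {0..} f"
  shows "trace_fun f L \<le> trace_fun f M / 2 + trace_fun f N / 2"
proof -
  obtain tau u where L': "spectral_decomposition L tau u" using hermitian_spectral_decomposition[OF L(1)] .
  obtain mu w where M': "spectral_decomposition M mu w" using hermitian_spectral_decomposition[OF M(1)] .
  obtain nu z where N': "spectral_decomposition N nu z" using hermitian_spectral_decomposition[OF N(1)] .
  have u: "orthonormal u" using L' by (simp add: spectral_decomposition_def)
  have eig: "Re (hinner (K *v y i) (y i)) = r i" if "spectral_decomposition K r y"
    for K :: "complex^'n^'n" and r y i
    using that by (simp add: spectral_decomposition_hinner[OF that]) 
      (simp add: spectral_decomposition_def orthonormal_hinner)
  txt \<open>The weights \<open>q\<close> form a doubly stochastic matrix.\<close>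
  have jensen: "\<exists>q. (\<forall>i. tanhc_quad a e K (u i) = (\<Sum>p\<in>UNIV. q i p * r p) \<and> 0 \<le> (\<Sum>p\<in>UNIV. q i p * r p) \<and>
        f (\<Sum>p\<in>UNIV. q i p * r p) \<le> (\<Sum>p\<in>UNIV. q i p * f (r p))) \<and>
      (\<forall>p. (\<Sum>i\<in>UNIV. q i p) = 1)"
    if K: "spectral_decomposition K r y" and r: "\<And>p. r p \<ge> 0" for K and r :: "'n \<Rightarrow> real" and y
  proof (intro exI conjI allI)
    \<comment> \<open>\<open>?q i p\<close> is the quadratic form at \<open>u i\<close> of \<Phi>
      applied to the projection onto \<open>y p\<close>. Row sums 1 express that \<Phi> is unital,
      column sums 1 that it preserves the trace.\<close>
    let ?q = "\<lambda>i p. tanhc_form a (\<lambda>j. hinner (u i) (e j) * hinner (e j) (y p))"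
    have y: "orthonormal y" using K by (simp add: spectral_decomposition_def)
    have row: "(\<Sum>p\<in>UNIV. ?q i p) = 1" for i
    proof -
      have "(\<Sum>p\<in>UNIV. ?q i p) = (\<Sum>j\<in>UNIV. (cmod (hinner (u i) (e j)))\<^sup>2)"
        using e by (intro tanhc_form_sum_orthonormal) (simp add: cnj_hinner orthonormal_hinner flip: parseval[OF y])
      also have "\<dots> = (norm (u i))\<^sup>2" by (rule parseval_norm[OF e, symmetric])
      also have "\<dots> = 1"
        using u hinner_self[of "u i"] unfolding orthonormal_hinner by (metis of_real_eq_1_iff)
      finally show ?thesis .
    qed
    show "(\<Sum>i\<in>UNIV. ?q i p) = 1" for p
    proof -
      \<comment> \<open>The factors trade places: now \<open>u\<close> is the orthonormal family
        summed over, and \<open>y p\<close> supplies the fixed coefficients.\<close>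
      have "(\<Sum>i\<in>UNIV. ?q i p) = (\<Sum>i\<in>UNIV. tanhc_form a (\<lambda>j. hinner (e j) (y p) * hinner (u i) (e j)))"
        by (simp add: mult.commute)
      also have "\<dots> = (\<Sum>j\<in>UNIV. (cmod (hinner (e j) (y p)))\<^sup>2)"
        using e by (intro tanhc_form_sum_orthonormal)
          (simp add: cnj_hinner orthonormal_hinner mult.commute flip: parseval[OF u])
      also have "\<dots> = (\<Sum>j\<in>UNIV. (cmod (hinner (y p) (e j)))\<^sup>2)"
        by (intro sum.cong refl) (metis cnj_hinner complex_mod_cnj)
      also have "\<dots> = (norm (y p))\<^sup>2" by (rule parseval_norm[OF e, symmetric])
      also have "\<dots> = 1"
        using y hinner_self[of "y p"] unfolding orthonormal_hinner by (metis of_real_eq_1_iff)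
      finally show ?thesis .
    qed
    fix i
    show "tanhc_quad a e K (u i) = (\<Sum>p\<in>UNIV. ?q i p * r p)"
      by (subst tanhc_quad_eq_sum_tanhc_form[OF spectral_hinner_mult[OF K]]) (simp add: mult.commute)
    show "0 \<le> (\<Sum>p\<in>UNIV. ?q i p * r p)"
      by (intro sum_nonneg mult_nonneg_nonneg tanhc_form_nonneg r)
    show "f (\<Sum>p\<in>UNIV. ?q i p * r p) \<le> (\<Sum>p\<in>UNIV. ?q i p * f (r p))"
      using convex_on_sum[OF _ _ f(2) row[of i] tanhc_form_nonneg, of r] r by simp
  qed
  \<comment> \<open>Positive semidefiniteness places all eigenvalues in \<open>{0..}\<close>, where
    \<open>f\<close> is monotone and convex.\<close>
  have tau: "tau i \<ge> 0" for i using L(2)[of "u i"] eig[OF L'] by simp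
  have mu: "mu i \<ge> 0" for i using M(2)[of "w i"] eig[OF M'] by simp
  have nu: "nu i \<ge> 0" for i using N(2)[of "z i"] eig[OF N'] by simp
  from jensen[OF M' mu] obtain q where
    q: "\<And>i. tanhc_quad a e M (u i) = (\<Sum>p\<in>UNIV. q i p * mu p)" "\<And>i. 0 \<le> (\<Sum>p\<in>UNIV. q i p * mu p)"
      "\<And>i. f (\<Sum>p\<in>UNIV. q i p * mu p) \<le> (\<Sum>p\<in>UNIV. q i p * f (mu p))" "\<And>p. (\<Sum>i\<in>UNIV. q i p) = 1"
    by blast
  from jensen[OF N' nu] obtain q' where
    q': "\<And>i. tanhc_quad a e N (u i) = (\<Sum>p\<in>UNIV. q' i p * nu p)" "\<And>i. 0 \<le> (\<Sum>p\<in>UNIV. q' i p * nu p)"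
      "\<And>i. f (\<Sum>p\<in>UNIV. q' i p * nu p) \<le> (\<Sum>p\<in>UNIV. q' i p * f (nu p))" "\<And>p. (\<Sum>i\<in>UNIV. q' i p) = 1"
    by blast
  have fle: "f (tau i) \<le> (\<Sum>p\<in>UNIV. q i p * f (mu p)) / 2 + (\<Sum>p\<in>UNIV. q' i p * f (nu p)) / 2" for i
  proof -
    let ?s = "\<Sum>p\<in>UNIV. q i p * mu p" and ?t = "\<Sum>p\<in>UNIV. q' i p * nu p"
    have "tau i \<le> ?s / 2 + ?t / 2" using le[of "u i"] eig[OF L', of i] q(1) q'(1) by simp
    then have "f (tau i) \<le> f (?s / 2 + ?t / 2)"
      using tau[of i] q(2)[of i] q'(2)[of i] by (intro mono_onD[OF f(1)]) auto
    also have "\<dots> \<le> f ?s / 2 + f ?t / 2"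
      using convex_onD[OF f(2), of "1/2" ?s ?t] q(2)[of i] q'(2)[of i] by simp
    also have "\<dots> \<le> (\<Sum>p\<in>UNIV. q i p * f (mu p)) / 2 + (\<Sum>p\<in>UNIV. q' i p * f (nu p)) / 2"
      using q(3)[of i] q'(3)[of i] by linarith
    finally show ?thesis .
  qed
  have ds: "(\<Sum>i\<in>UNIV. \<Sum>p\<in>UNIV. s i p * f (r p)) = (\<Sum>p\<in>UNIV. f (r p))"
    if "\<And>p. (\<Sum>i\<in>UNIV. s i p) = 1" for s :: "'n \<Rightarrow> 'n \<Rightarrow> real" and r
    by (subst sum.swap) (simp add: that flip: sum_distrib_right)
  have "trace_fun f L = (\<Sum>i\<in>UNIV. f (tau i))" by (rule trace_fun_spectral[OF L'])
  also have "\<dots> \<le> (\<Sum>i\<in>UNIV. (\<Sum>p\<in>UNIV. q i p * f (mu p)) / 2 + (\<Sum>p\<in>UNIV. q' i p * f (nu p)) / 2)"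
    by (intro sum_mono fle)
  also have "\<dots> = trace_fun f M / 2 + trace_fun f N / 2"
    by (simp add: sum.distrib ds[OF q(4)] ds[OF q'(4)] trace_fun_spectral[OF M'] trace_fun_spectral[OF N']
      flip: sum_divide_distrib)
  finally show ?thesis .
qed

section \<open>Hermitian products and entrywise expectations\<close>

lemma hermitian_sandwich:
  assumes "hermitian H" "hermitian N"
  shows "hermitian (H ** N ** H)"
proof -
  have H: "cnj (H $ i $ j) = H $ j $ i" and N: "cnj (N $ i $ j) = N $ j $ i" for i j
    using assms unfolding hermitian_def by metis+
  have 1: "(H ** N ** H) $ i $ j = (\<Sum>k\<in>UNIV. \<Sum>l\<in>UNIV. H $ i $ l * N $ l $ k * H $ k $ j)" for i j
    by (simp add: matrix_matrix_mult_def sum_distrib_right)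
  have 2: "cnj ((H ** N ** H) $ j $ i) = (\<Sum>k\<in>UNIV. \<Sum>l\<in>UNIV. H $ i $ k * N $ k $ l * H $ l $ j)" for i j
    by (simp add: matrix_matrix_mult_def sum_distrib_left H N mult_ac)
  show ?thesis unfolding hermitian_def 2 by (intro allI, subst 1) (rule sum.swap)
qed

lemma hermitian_square:
  assumes "hermitian H"
  shows "hermitian (H ** H)"
proof -
  have "hermitian (mat 1)" by (simp add: hermitian_def mat_def)
  then show ?thesis using hermitian_sandwich[OF assms, of "mat 1"] by simp
qed

text \<open>For fixed vectors this is a linear combination of the matrix entries.\<close>

lemma integrable_hinner:
  assumes "mat_integrable P X"
  shows "integrable P (\<lambda>\<omega>. hinner (X \<omega> *v x) y)"
    and "integral\<^sup>L P (\<lambda>\<omega>. hinner (X \<omega> *v x) y) = hinner (mat_expectation P X *v x) y"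
proof -
  have X: "integrable P (\<lambda>\<omega>. X \<omega> $ i $ j)" for i j
    using assms by (simp add: mat_integrable_def)
  have eq: "hinner (N *v x) y = (\<Sum>i\<in>UNIV. \<Sum>j\<in>UNIV. N $ i $ j * (x $ j * cnj (y $ i)))" for N
    by (simp add: hinner_def matrix_vector_mult_def sum_distrib_left mult_ac)
  show "integrable P (\<lambda>\<omega>. hinner (X \<omega> *v x) y)"
    unfolding eq by (intro Bochner_Integration.integrable_sum integrable_mult_left X)
  show "integral\<^sup>L P (\<lambda>\<omega>. hinner (X \<omega> *v x) y) = hinner (mat_expectation P X *v x) y"
    unfolding eq by (simp add: X mat_expectation_def)
qed

text \<open>With \<open>a\<close> and \<open>e\<close> deterministic, \<open>tanhc_quad\<close> is
  real-linear in the matrix. This is why the random eigenvalues had to leave the kernel before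
  taking expectations.\<close>

lemma integrable_tanhc_quad:
  assumes X: "mat_integrable P X"
  shows "integrable P (\<lambda>\<omega>. tanhc_quad a e (X \<omega>) x)"
    and "integral\<^sup>L P (\<lambda>\<omega>. tanhc_quad a e (X \<omega>) x) = tanhc_quad a e (mat_expectation P X) x"
proof -
  show "integrable P (\<lambda>\<omega>. tanhc_quad a e (X \<omega>) x)"
    unfolding tanhc_quad_def
    by (intro integrable_Re Bochner_Integration.integrable_sum integrable_mult_right integrable_hinner X)
  show "integral\<^sup>L P (\<lambda>\<omega>. tanhc_quad a e (X \<omega>) x) = tanhc_quad a e (mat_expectation P X) x"
    unfolding tanhc_quad_def
    by (subst integral_Re)
      (auto intro!: Bochner_Integration.integrable_sum integrable_mult_right integrable_hinner X
        simp: integrable_hinner[OF X])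
qed

lemma mat_expectation_sandwich:
  assumes "mat_integrable P X"
  shows "mat_integrable P (\<lambda>\<omega>. H ** X \<omega> ** K)"
    and "mat_expectation P (\<lambda>\<omega>. H ** X \<omega> ** K) = H ** mat_expectation P X ** K"
proof -
  have X: "integrable P (\<lambda>\<omega>. X \<omega> $ i $ j)" for i j
    using assms by (simp add: mat_integrable_def)
  show "mat_integrable P (\<lambda>\<omega>. H ** X \<omega> ** K)"
    unfolding mat_integrable_def matrix_matrix_mult_def by (simp add: X)
  show "mat_expectation P (\<lambda>\<omega>. H ** X \<omega> ** K) = H ** mat_expectation P X ** K"
    by (simp add: mat_expectation_def matrix_matrix_mult_def vec_eq_iff X)
qed

lemma mat_expectation_psd:
  assumes X: "mat_integrable P X" and H: "\<And>\<omega>. \<omega> \<in> space P \<Longrightarrow> hermitian (X \<omega>)"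
    and nn: "\<And>\<omega> x. \<omega> \<in> space P \<Longrightarrow> 0 \<le> Re (hinner (X \<omega> *v x) x)"
  shows "hermitian (mat_expectation P X)" "0 \<le> Re (hinner (mat_expectation P X *v x) x)"
proof -
  show "hermitian (mat_expectation P X)"
    unfolding hermitian_def
  proof (intro allI)
    fix i j
    have "integral\<^sup>L P (\<lambda>\<omega>. X \<omega> $ i $ j) = integral\<^sup>L P (\<lambda>\<omega>. cnj (X \<omega> $ j $ i))"
      using H unfolding hermitian_def by (intro Bochner_Integration.integral_cong refl) blast
    then show "mat_expectation P X $ i $ j = cnj (mat_expectation P X $ j $ i)"
      by (simp add: mat_expectation_def)
  qed
  have "0 \<le> integral\<^sup>L P (\<lambda>\<omega>. Re (hinner (X \<omega> *v x) x))"
    using nn by (intro integral_nonneg_AE AE_I2) auto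
  then show "0 \<le> Re (hinner (mat_expectation P X *v x) x)"
    using integrable_hinner[OF X] by (simp add: integral_Re)
qed

text \<open>Of two points \<open>x < y\<close> only \<open>x\<close> can be 0. In that case
  \<open>0 powr p = 0\<close> reduces the claim to \<open>t powr p \<le> t\<close> for
  \<open>t\<close> between 0 and 1; otherwise \<open>powr_convex\<close> applies.\<close>

lemma convex_on_powr_atLeast_0:
  assumes "p \<ge> 1"
  shows "convex_on {0..} (\<lambda>x::real. x powr p)"
proof (rule convex_on_linorderI)
  fix t x y :: real
  assume t: "0 < t" "t < 1" and x: "x \<in> {0..}" and "y \<in> {0..}" and "x < y"
  then have y: "y > 0" by simp
  show "((1 - t) *\<^sub>R x + t *\<^sub>R y) powr p \<le> (1 - t) * x powr p + t * y powr p"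
  proof (cases "x = 0")
    case True
    have "t powr p \<le> t powr 1" using t assms by (intro powr_mono') auto
    then have "t powr p * y powr p \<le> t * y powr p" using t by (intro mult_right_mono) auto
    then show ?thesis using True t y by (simp add: powr_mult)
  next
    case False
    then show ?thesis
      using convex_onD[OF powr_convex[OF assms], of t x y] t x y by simp
  qed
qed simp

theorem theorem3p3:
  fixes P :: "'w measure"
    and A :: "complex^'n^'n"
    and B :: "'w \<Rightarrow> complex^'n^'n"
  assumes "prob_space P"
    and "hermitian A"
    and "B \<in> borel_measurable P"
    and "\<And>\<omega>. \<omega> \<in> space P \<Longrightarrow> hermitian (B \<omega>)"
    and "mat_integrable P (\<lambda>\<omega>. (matrix_exp A - matrix_exp (B \<omega>)) ** (matrix_exp A - matrix_exp (B \<omega>)))"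
    and "mat_integrable P (\<lambda>\<omega>. (A - B \<omega>) ** matrix_exp (2 *\<^sub>R B \<omega>) ** (A - B \<omega>))"
    and "mat_integrable P (\<lambda>\<omega>. (A - B \<omega>) ** (A - B \<omega>))"
  shows "(\<forall>f :: real \<Rightarrow> real.
            (\<forall>t\<ge>0. f t \<ge> 0) \<and> mono_on {0..} f \<and> convex_on {0..} f \<longrightarrow>
            trace_fun f (mat_expectation P
                (\<lambda>\<omega>. (matrix_exp A - matrix_exp (B \<omega>)) ** (matrix_exp A - matrix_exp (B \<omega>))))
            \<le> 1/2 * trace_fun f (mat_expectation P
                (\<lambda>\<omega>. (A - B \<omega>) ** matrix_exp (2 *\<^sub>R B \<omega>) ** (A - B \<omega>)))
              + 1/2 * trace_fun f (matrix_exp A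
                ** mat_expectation P (\<lambda>\<omega>. (A - B \<omega>) ** (A - B \<omega>)) ** matrix_exp A))
       \<and> (\<forall>p::real. p \<ge> 1 \<longrightarrow>
            trace_fun (\<lambda>t. t powr p) (mat_expectation P
                (\<lambda>\<omega>. (matrix_exp A - matrix_exp (B \<omega>)) ** (matrix_exp A - matrix_exp (B \<omega>))))
            \<le> 1/2 * trace_fun (\<lambda>t. t powr p) (mat_expectation P
                (\<lambda>\<omega>. (A - B \<omega>) ** matrix_exp (2 *\<^sub>R B \<omega>) ** (A - B \<omega>)))
              + 1/2 * trace_fun (\<lambda>t. t powr p) (matrix_exp A
                ** mat_expectation P (\<lambda>\<omega>. (A - B \<omega>) ** (A - B \<omega>)) ** matrix_exp A))"
proof -
  define D where "D \<omega> = A - B \<omega>" for \<omega>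
  define X where "X \<omega> = (matrix_exp A - matrix_exp (B \<omega>)) ** (matrix_exp A - matrix_exp (B \<omega>))" for \<omega>
  define Y where "Y \<omega> = D \<omega> ** matrix_exp (2 *\<^sub>R B \<omega>) ** D \<omega>" for \<omega>
  define Z where "Z \<omega> = D \<omega> ** D \<omega>" for \<omega>
  \<comment> \<open>The pointwise bound involves \<open>W\<close>, the theorem the expectation of
    \<open>Z\<close>; \<open>EW\<close> passes between them since the outer factors are
    deterministic.\<close>
  define W where "W \<omega> = matrix_exp A ** Z \<omega> ** matrix_exp A" for \<omega>
  obtain a e where A: "spectral_decomposition A a e"
    using hermitian_spectral_decomposition[OF assms(2)] .
  have e: "orthonormal e" using A by (simp add: spectral_decomposition_def)
  have hA: "hermitian (matrix_exp A)" using hermitian_matrix_fun[OF A] .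
  have intX: "mat_integrable P X" and intY: "mat_integrable P Y" and intZ: "mat_integrable P Z"
    using assms(5-7) by (simp_all add: X_def[abs_def] Y_def[abs_def] Z_def[abs_def] D_def)
  note intW = mat_expectation_sandwich(1)[OF intZ, of "matrix_exp A" "matrix_exp A", folded W_def]
  note EW = mat_expectation_sandwich(2)[OF intZ, of "matrix_exp A" "matrix_exp A", folded W_def]
  have pointwise: "hermitian (X \<omega>) \<and> hermitian (Y \<omega>) \<and> hermitian (W \<omega>) \<and>
      0 \<le> Re (hinner (X \<omega> *v x) x) \<and> 0 \<le> Re (hinner (Y \<omega> *v x) x) \<and> 0 \<le> Re (hinner (W \<omega> *v x) x) \<and>
      Re (hinner (X \<omega> *v x) x) \<le> tanhc_quad a e (Y \<omega>) x / 2 + tanhc_quad a e (W \<omega>) x / 2"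
    if \<omega>: "\<omega> \<in> space P" for \<omega> x
  proof -
    obtain b v where B: "spectral_decomposition (B \<omega>) b v"
      using hermitian_spectral_decomposition[OF assms(4)[OF \<omega>]] .
    have T: "hermitian (matrix_exp A - matrix_exp (B \<omega>))"
      by (rule hermitian_diff[OF hA hermitian_matrix_fun[OF B]])
    have D: "hermitian (D \<omega>)" unfolding D_def by (rule hermitian_diff[OF assms(2) assms(4)[OF \<omega>]])
    \<comment> \<open>In the eigenbasis \<open>v\<close> of \<open>B \<omega>\<close> the form of
      \<open>Y \<omega>\<close> becomes a sum of squared moduli with the positive weights
      \<open>exp (2 * b k)\<close>.\<close>
    note E = matrix_fun_spectral_decomposition[OF spectral_decomposition_scaleR[OF B], of exp 2]
    have "0 \<le> Re (hinner (Y \<omega> *v x) x)"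
      unfolding Y_def hinner_sandwich[OF D] spectral_hinner_mult[OF E] Re_sum
      by (intro sum_nonneg) (simp add: complex_norm_square[symmetric])
    moreover have "0 \<le> Re (hinner (X \<omega> *v x) x)" "0 \<le> Re (hinner (W \<omega> *v x) x)"
      unfolding X_def W_def Z_def hinner_sandwich[OF hA] hinner_square[OF T] hinner_square[OF D] hinner_self
      by simp_all
    ultimately show ?thesis
      using exp_diff_square_le[OF A B, of x] hermitian_square[OF T] hermitian_square[OF D]
        hermitian_sandwich[OF hA, of "Z \<omega>"] hermitian_sandwich[OF D spectral_decomposition_hermitian[OF E]]
      by (simp add: X_def Y_def Z_def W_def D_def)
  qed
  have le: "Re (hinner (mat_expectation P X *v x) x) \<le>
      tanhc_quad a e (mat_expectation P Y) x / 2 + tanhc_quad a e (mat_expectation P W) x / 2" for x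
  proof -
    note int = integrable_hinner[OF intX] integrable_tanhc_quad[OF intY] integrable_tanhc_quad[OF intW]
    have "Re (hinner (mat_expectation P X *v x) x) = integral\<^sup>L P (\<lambda>\<omega>. Re (hinner (X \<omega> *v x) x))"
      by (simp add: int)
    also have "\<dots> \<le> integral\<^sup>L P (\<lambda>\<omega>. tanhc_quad a e (Y \<omega>) x / 2 + tanhc_quad a e (W \<omega>) x / 2)"
      using pointwise by (intro integral_mono Bochner_Integration.integrable_add integrable_divide integrable_Re int) auto
    also have "\<dots> = tanhc_quad a e (mat_expectation P Y) x / 2 + tanhc_quad a e (mat_expectation P W) x / 2"
      by (simp add: int)
    finally show ?thesis .
  qed
  have main: "trace_fun f (mat_expectation P X) \<le>
      1/2 * trace_fun f (mat_expectation P Y) + 1/2 * trace_fun f (matrix_exp A ** mat_expectation P Z ** matrix_exp A)"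
    if "mono_on {0..} f" "convex_on {0..} f" for f
    unfolding EW[symmetric]
    using trace_fun_le_if_quad_le[OF e mat_expectation_psd[OF intX] mat_expectation_psd[OF intY] mat_expectation_psd[OF intW] le that]
      pointwise by simp
  have "mono_on {0..} (\<lambda>t. t powr p)" if "p \<ge> 1" for p :: real
    using that by (intro mono_onI powr_mono2) auto
  then show ?thesis
    using main convex_on_powr_atLeast_0 unfolding X_def Y_def Z_def D_def by blast
qed

end
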